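(* Let $E$ be a uniformly convex (real) Banach space whose dual $E^*$ has the Kadec--Klee property. Let $K$ be a bounded and convex subset of $E$ and let $T:K\to K$ be a mapping satisfying the (RSC)-condition. Let $\alpha\in[1/2,1)$ be a real number, let $x_1\in K$ be arbitrary but fixed, and define the sequence $\{x_n\}$ in $K$ by $$x_{n+1}=\alpha Tx_n+(1-\alpha)x_n \qquad (n\ge 1).$$ Assume that $\lim_{n\to\infty}\|Tx_n-x_n\|=0$. Then $\{x_n\}$ converges weakly to a fixed point of $T$.
   Context: All Banach spaces are real. A mapping $T$ on a subset $K$ of a Banach space $E$ is a map $T:K\to K$. (RSC)-condition (Reich--Suzuki-(C) condition): $T$ satisfies the (RSC)-condition if for all $x,y\in K$, the inequality $\frac12\|x-Tx\|\le\|x-y\|$ implies $$\|Tx-Ty\|\le\tfrac13\left(\|x-y\|+\|y-Ty\|+\|x-Tx\|\right).$$ Kadec--Klee property: a Banach space $X$ has the Kadec--Klee property if every sequence $\{x_n\}$ in $X$ which converges weakly to some $x\in X$ and satisfies $\|x_n\|\to\|x\|$ converges strongly to $x$.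
   Formalization: The set K is additionally assumed to be closed; without this the claim fails, e.g. for E = R, K = (0,1], Tx = x/2, α = 1/2, where all hypotheses hold but T has no fixed point in K. *)

theory Defs
  imports "HOL-Analysis.Analysis"
begin

definition uniformly_convex :: "'a::real_normed_vector itself \<Rightarrow> bool" where
  "uniformly_convex _ \<longleftrightarrow>
     (\<forall>\<epsilon>::real. 0 < \<epsilon> \<and> \<epsilon> \<le> 2 \<longrightarrow>
       (\<exists>\<delta>>0. \<forall>x y::'a. norm x \<le> 1 \<and> norm y \<le> 1 \<and> norm (x - y) \<ge> \<epsilon> \<longrightarrow>
          norm ((x + y) /\<^sub>R 2) \<le> 1 - \<delta>))"

text \<open>Functionals are bounded linear maps to the reals, so the dual of the space carried by
  \<open>'a\<close>, with its operator norm, is \<open>'a \<Rightarrow>\<^sub>L real\<close>.  Used at that type, the definition below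
  tests against the whole bidual, i.e. it is weak and not weak-star convergence.\<close>

definition weakly_converges :: "(nat \<Rightarrow> 'a::real_normed_vector) \<Rightarrow> 'a \<Rightarrow> bool" where
  "weakly_converges x l \<longleftrightarrow>
     (\<forall>f :: 'a \<Rightarrow>\<^sub>L real. (\<lambda>n. blinfun_apply f (x n)) \<longlonglongrightarrow> blinfun_apply f l)"

definition kadec_klee :: "'a::real_normed_vector itself \<Rightarrow> bool" where
  "kadec_klee _ \<longleftrightarrow>
     (\<forall>(x :: nat \<Rightarrow> 'a) l.
        weakly_converges x l \<and> (\<lambda>n. norm (x n)) \<longlonglongrightarrow> norm l \<longrightarrow> x \<longlonglongrightarrow> l)"

definition rsc_condition :: "'a::real_normed_vector set \<Rightarrow> ('a \<Rightarrow> 'a) \<Rightarrow> bool" where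
  "rsc_condition K T \<longleftrightarrow>
     (\<forall>x\<in>K. \<forall>y\<in>K. 1/2 * norm (x - T x) \<le> norm (x - y) \<longrightarrow>
        norm (T x - T y) \<le> 1/3 * (norm (x - y) + norm (y - T y) + norm (x - T x)))"

text \<open>Fixed points of a self-map of \<open>K\<close> have to lie in \<open>K\<close>, so the convergence theorem needs
  \<open>K\<close> to be closed: halving on the interval from 0 (excluded) to 1 (included) satisfies all
  its other hypotheses and has no fixed point.\<close>

end

theory Submission
  imports Defs
begin

text \<open>
  The three terms on the right of the (RSC)-condition carry weight \<open>1/3\<close> each, so up to
  displacements \<open>T\<close> contracts distances by the factor \<open>1/3\<close>.  Two points of \<open>K\<close> that \<open>T\<close> hardly
  moves are therefore close to each other: their distance is at most twice the sum of their
  displacements (\<open>rsc_dist_le_displacements\<close>).  A sequence in \<open>K\<close> with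
  \<open>\<parallel>T x\<^sub>n - x\<^sub>n\<parallel> \<longlonglongrightarrow> 0\<close> is then a Cauchy sequence, so it converges in norm, to a
  point \<open>p\<close> of the closed set \<open>K\<close>.

  That \<open>p\<close> is fixed does not follow from continuity, which \<open>T\<close> need not have.  Instead the
  displacement of \<open>p\<close> is estimated by the distance from \<open>p\<close> to \<open>x\<^sub>n\<close> and the displacement of
  \<open>x\<^sub>n\<close> (\<open>rsc_displacement_le\<close>), both of which vanish in the limit.  Convexity of \<open>K\<close> keeps the
  iterates in \<open>K\<close>, and norm convergence implies weak convergence.
\<close>

lemma rsc_conditionD:
  assumes "rsc_condition K T" "x \<in> K" "y \<in> K" "1/2 * norm (x - T x) \<le> norm (x - y)"
  shows "norm (T x - T y) \<le> 1/3 * (norm (x - y) + norm (y - T y) + norm (x - T x))"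
  using assms unfolding rsc_condition_def by blast

lemma norm_diff_le_via_images:
  fixes x y :: "'a::real_normed_vector"
  shows "norm (x - y) \<le> norm (x - T x) + norm (T x - T y) + norm (y - T y)"
proof -
  have "norm ((x - T x) + (T x - T y) - (y - T y))
      \<le> norm (x - T x) + norm (T x - T y) + norm (y - T y)"
    by (meson norm_triangle_ineq norm_triangle_ineq4 add_right_mono order_trans)
  then show ?thesis
    by simp
qed

text \<open>If \<open>x\<close> and \<open>y\<close> are too close for the (RSC)-condition to apply, their distance is already
  below half a displacement.  Otherwise the condition bounds \<open>\<parallel>x - y\<parallel>\<close> by a third of itself plus
  displacements, and the third can be absorbed on the left.\<close>

lemma rsc_dist_le_displacements:
  assumes "rsc_condition K T" "x \<in> K" "y \<in> K"
  shows "norm (x - y) \<le> 2 * (norm (x - T x) + norm (y - T y))"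
proof (cases "1/2 * norm (x - T x) \<le> norm (x - y)")
  case True
  then show ?thesis
    using rsc_conditionD[OF assms True] norm_diff_le_via_images[of x y T] by argo
next
  case False
  then show ?thesis
    using norm_ge_zero[of "x - T x"] norm_ge_zero[of "y - T y"] by argo
qed

text \<open>The (RSC)-condition always applies to \<open>x\<close> and \<open>T x\<close>, since their distance is the
  displacement of \<open>x\<close> itself.\<close>

lemma rsc_displacement_image_le:
  assumes "rsc_condition K T" "x \<in> K" "T x \<in> K"
  shows "norm (T x - T (T x)) \<le> norm (x - T x)"
  using rsc_conditionD[OF assms] norm_ge_zero[of "x - T x"] by simp

text \<open>The (RSC)-condition applies to \<open>p\<close> together with \<open>x\<close> or with \<open>T x\<close>: if \<open>p\<close> were closer to
  each of them than half its displacement, the triangle inequality through \<open>p\<close> would put \<open>x\<close> and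
  \<open>T x\<close> closer together than the displacement of \<open>x\<close>.\<close>

lemma rsc_applicable_at_point_or_image:
  assumes "rsc_condition K T" "x \<in> K" "T x \<in> K"
  shows "1/2 * norm (x - T x) \<le> norm (x - p)
    \<or> 1/2 * norm (T x - T (T x)) \<le> norm (T x - p)"
  using rsc_displacement_image_le[OF assms] norm_triangle_ineq4[of "x - p" "T x - p"]
  by auto

text \<open>The displacement of \<open>p\<close> enters the (RSC)-estimate for \<open>\<parallel>T z - T p\<parallel>\<close> with weight only
  \<open>1/3\<close>, so it can be absorbed.  Whichever of \<open>x\<close> and \<open>T x\<close> serves as \<open>z\<close>, it is within
  \<open>\<parallel>x - T x\<parallel>\<close> of \<open>x\<close> and has displacement at most \<open>\<parallel>x - T x\<parallel>\<close>.\<close>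

lemma rsc_displacement_le:
  assumes rsc: "rsc_condition K T" and K: "x \<in> K" "T x \<in> K" "p \<in> K"
  shows "norm (p - T p) \<le> 2 * norm (x - p) + 4 * norm (x - T x)"
proof -
  obtain z where "z \<in> K"
    and applicable: "1/2 * norm (z - T z) \<le> norm (z - p)"
    and near: "norm (z - p) \<le> norm (x - p) + norm (x - T x)"
    and moved: "norm (z - T z) \<le> norm (x - T x)"
  proof -
    have "norm (T x - p) \<le> norm (x - p) + norm (x - T x)"
      using norm_triangle_ineq4[of "x - p" "x - T x"] by simp
    then show ?thesis
      using rsc_applicable_at_point_or_image[OF rsc K(1,2), of p]
        rsc_displacement_image_le[OF rsc K(1,2)] that[of x] that[of "T x"] K
      by fastforce
  qed
  have "norm (p - T p) \<le> norm (z - p) + norm (z - T z) + norm (T z - T p)"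
  proof -
    have "norm ((z - p) - (z - T z) - (T z - T p))
        \<le> norm (z - p) + norm (z - T z) + norm (T z - T p)"
      by (meson norm_triangle_ineq4 add_right_mono order_trans)
    then show ?thesis
      by (simp add: norm_minus_commute)
  qed
  then show ?thesis
    using rsc_conditionD[OF rsc \<open>z \<in> K\<close> K(3) applicable] near moved by argo
qed

text \<open>The sequence is Cauchy because any two of its members are as close as their displacements
  force them to be, whether or not the indices are near each other.\<close>

lemma rsc_approximate_fixed_points_converge:
  fixes u :: "nat \<Rightarrow> 'a::banach"
  assumes rsc: "rsc_condition K T" and T: "T \<in> K \<rightarrow> K" and "closed K"
    and u: "\<And>n. u n \<in> K"
    and lim: "(\<lambda>n. norm (u n - T (u n))) \<longlonglongrightarrow> 0"
  shows "\<exists>p\<in>K. T p = p \<and> u \<longlonglongrightarrow> p"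
proof -
  have "Cauchy u"
  proof (rule CauchyI)
    fix e :: real
    assume "0 < e"
    then obtain N where N: "\<And>n. n \<ge> N \<Longrightarrow> norm (u n - T (u n)) < e/4"
      using LIMSEQ_D[OF lim, of "e/4"] by auto
    have "norm (u m - u n) < e" if "m \<ge> N" "n \<ge> N" for m n
      using rsc_dist_le_displacements[OF rsc u u, of m n] N[OF that(1)] N[OF that(2)]
      by argo
    then show "\<exists>N. \<forall>m\<ge>N. \<forall>n\<ge>N. norm (u m - u n) < e"
      by blast
  qed
  then obtain p where p: "u \<longlonglongrightarrow> p"
    using Cauchy_convergent convergent_def by blast
  then have "p \<in> K"
    using closed_sequentially[OF \<open>closed K\<close>] u by blast
  have "norm (p - T p) \<le> 2 * norm (u n - p) + 4 * norm (u n - T (u n))" for n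
    using rsc_displacement_le[OF rsc u _ \<open>p \<in> K\<close>] T u by blast
  moreover have "(\<lambda>n. 2 * norm (u n - p) + 4 * norm (u n - T (u n))) \<longlonglongrightarrow> 2 * 0 + 4 * 0"
    by (intro tendsto_add tendsto_mult tendsto_const lim tendsto_norm_zero[OF LIM_zero[OF p]])
  ultimately have "norm (p - T p) \<le> 0"
    using LIMSEQ_le_const by fastforce
  then have "T p = p"
    by simp
  then show ?thesis
    using \<open>p \<in> K\<close> p by blast
qed

lemma tendsto_imp_weakly_converges:
  assumes "x \<longlonglongrightarrow> l"
  shows "weakly_converges x l"
  unfolding weakly_converges_def by (intro allI tendsto_intros assms)

theorem theorem4:
  fixes K :: "'a::banach set" and T :: "'a \<Rightarrow> 'a" and \<alpha> :: real and x :: "nat \<Rightarrow> 'a"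
  assumes "uniformly_convex TYPE('a)"
    and "kadec_klee TYPE('a \<Rightarrow>\<^sub>L real)"
    and "bounded K" and "convex K" and "closed K"
    and "T \<in> K \<rightarrow> K"
    and "rsc_condition K T"
    and "1/2 \<le> \<alpha>" and "\<alpha> < 1"
    and "x 1 \<in> K"
    and "\<And>n. n \<ge> 1 \<Longrightarrow> x (n + 1) = \<alpha> *\<^sub>R T (x n) + (1 - \<alpha>) *\<^sub>R x n"
    and "(\<lambda>n. norm (T (x n) - x n)) \<longlonglongrightarrow> 0"
  shows "\<exists>p\<in>K. T p = p \<and> weakly_converges x p"
proof -
  \<comment> \<open>The value \<open>x 0\<close> is arbitrary and may lie outside \<open>K\<close>, hence the shift by one.\<close>
  have iterates: "x (Suc n) \<in> K" for n
  proof (induction n)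
    case 0
    then show ?case
      using \<open>x 1 \<in> K\<close> by simp
  next
    case (Suc n)
    then have "\<alpha> *\<^sub>R T (x (Suc n)) + (1 - \<alpha>) *\<^sub>R x (Suc n) \<in> K"
      using assms(4,6,8,9) by (intro convexD) auto
    then show ?case
      using assms(11)[of "Suc n"] by simp
  qed
  have "(\<lambda>n. norm (x (Suc n) - T (x (Suc n)))) \<longlonglongrightarrow> 0"
    using LIMSEQ_Suc[OF assms(12)] by (simp add: norm_minus_commute)
  then obtain p where "p \<in> K" "T p = p" "(\<lambda>n. x (Suc n)) \<longlonglongrightarrow> p"
    using rsc_approximate_fixed_points_converge[OF assms(7,6,5), of "\<lambda>n. x (Suc n)"] iterates
    by blast
  then show ?thesis
    using tendsto_imp_weakly_converges LIMSEQ_imp_Suc by blast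
qed

end
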